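(* Let $X$ be a space and let $\mathscr{P}$ be a closed hereditary topological property preserved under finite sums of closed subspaces. Let $X=X_1\cup\cdots\cup X_n$ (with $n\geq 1$), where each of $X_1,\ldots,X_n$ is a closed $\mathscr{P}$-connected subspace of $X$. If there exists a closed subspace $A$ of $X$ which is $\mathscr{P}$-connected, does not have $\mathscr{P}$, and satisfies $A\subseteq X_1\cap\cdots\cap X_n$, then $X$ is $\mathscr{P}$-connected.
   Context: A topological property is a property of topological spaces invariant under homeomorphism. A zero-set of a space $X$ is a set $f^{-1}(0)$ with $f:X\to[0,1]$ continuous; a cozero-set of $X$ is the complement in $X$ of a zero-set. $\mathrm{Coz}(X)$ denotes the set of all cozero-sets of $X$. Let $\mathscr{P}$ be a topological property. A $\mathscr{P}$-separation for a space $X$ is a pair $C,D\in\mathrm{Coz}(X)$ such that: $C$ and $D$ are disjoint; neither $\mathrm{cl}_XC$ nor $\mathrm{cl}_XD$ has $\mathscr{P}$; and $X\setminus(C\cup D)\subseteq E$ for some $E\in\mathrm{Coz}(X)$ such that $\mathrm{cl}_XE$ has $\mathscr{P}$. The space $X$ is $\mathscr{P}$-disconnected if there is a $\mathscr{P}$-separation for it, and $\mathscr{P}$-connected otherwise. A subspace is $\mathscr{P}$-connected if it is so as a space in its own right. $\mathscr{P}$ is closed hereditary if every closed subspace of a space with $\mathscr{P}$ has $\mathscr{P}$. $\mathscr{P}$ is preserved under finite sums of closed subspaces if any space that is a finite union of closed subspaces each having $\mathscr{P}$ also has $\mathscr{P}$. *)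

theory Defs
  imports "HOL-Analysis.Analysis"
begin

text \<open>
  A property \<open>P\<close> of spaces is a predicate on the topologies over one type, whose carriers may be
  arbitrary subsets of that type; every subspace of a space is again such a topology. The
  hypotheses on \<open>P\<close> below therefore only concern spaces over that type, so they hold for the
  restriction of any property of all topological spaces that satisfies them.
\<close>

definition topological_property :: "('a topology \<Rightarrow> bool) \<Rightarrow> bool" where
  "topological_property P \<longleftrightarrow> (\<forall>X Y. X homeomorphic_space Y \<longrightarrow> P X = P Y)"

definition zero_set :: "'a topology \<Rightarrow> 'a set \<Rightarrow> bool" where
  "zero_set X Z \<longleftrightarrow>
     (\<exists>f. continuous_map X (top_of_set {0..1::real}) f \<and> Z = {x \<in> topspace X. f x = 0})"

definition Coz :: "'a topology \<Rightarrow> 'a set set" where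
  "Coz X = {topspace X - Z | Z. zero_set X Z}"

definition P_separation :: "('a topology \<Rightarrow> bool) \<Rightarrow> 'a topology \<Rightarrow> 'a set \<Rightarrow> 'a set \<Rightarrow> bool" where
  "P_separation P X C D \<longleftrightarrow>
     C \<in> Coz X \<and> D \<in> Coz X \<and> C \<inter> D = {} \<and>
     \<not> P (subtopology X (X closure_of C)) \<and> \<not> P (subtopology X (X closure_of D)) \<and>
     (\<exists>E \<in> Coz X. topspace X - (C \<union> D) \<subseteq> E \<and> P (subtopology X (X closure_of E)))"

definition P_disconnected :: "('a topology \<Rightarrow> bool) \<Rightarrow> 'a topology \<Rightarrow> bool" where
  "P_disconnected P X \<longleftrightarrow> (\<exists>C D. P_separation P X C D)"

definition P_connected :: "('a topology \<Rightarrow> bool) \<Rightarrow> 'a topology \<Rightarrow> bool" where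
  "P_connected P X \<longleftrightarrow> \<not> P_disconnected P X"

definition closed_hereditary :: "('a topology \<Rightarrow> bool) \<Rightarrow> bool" where
  "closed_hereditary P \<longleftrightarrow> (\<forall>X S. P X \<and> closedin X S \<longrightarrow> P (subtopology X S))"

text \<open>
  Only nonempty finite unions are considered: the empty union would force the empty space to
  have \<open>P\<close>, which is not assumed.
\<close>

definition preserved_under_finite_closed_sums :: "('a topology \<Rightarrow> bool) \<Rightarrow> bool" where
  "preserved_under_finite_closed_sums P \<longleftrightarrow>
     (\<forall>X \<F>. finite \<F> \<and> \<F> \<noteq> {} \<and> topspace X = \<Union>\<F> \<and>
            (\<forall>S \<in> \<F>. closedin X S \<and> P (subtopology X S)) \<longrightarrow> P X)"

end

theory Submission
  imports Defs
begin

text \<open>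
  A separation \<open>(C, D)\<close> of \<open>X\<close> restricts to every closed \<open>\<P>\<close>-connected subspace \<open>Y\<close>, so one of
  \<open>cl (C \<inter> Y)\<close> and \<open>cl (D \<inter> Y)\<close> has \<open>\<P>\<close>. For \<open>Y = A\<close> exactly one of them does, as \<open>A\<close> itself does
  not have \<open>\<P>\<close>; say it is \<open>cl (C \<inter> A)\<close>. Since \<open>A \<subseteq> X\<^sub>i\<close> and \<open>\<P>\<close> is closed hereditary,
  \<open>cl (D \<inter> X\<^sub>i)\<close> cannot have \<open>\<P>\<close>, so \<open>cl (C \<inter> X\<^sub>i)\<close> does, for every \<open>i\<close>. Hence \<open>cl C\<close>, the union of
  these finitely many sets, has \<open>\<P>\<close>, a contradiction.
\<close>

lemma closed_hereditary_mono:
  assumes "closed_hereditary P" "P (subtopology X T)" "closedin X S" "S \<subseteq> T"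
  shows "P (subtopology X S)"
proof -
  have "P (subtopology (subtopology X T) S)"
    using assms closedin_subset_topspace unfolding closed_hereditary_def by blast
  then show ?thesis
    using \<open>S \<subseteq> T\<close> by (simp add: subtopology_subtopology Int_absorb1)
qed

text \<open>The sum condition concerns a space that is the whole union, so it is applied to the
  subspace \<open>\<Union>\<F>\<close>, in which each member stays closed and keeps its
  topology.\<close>

lemma preserved_under_finite_closed_sums_Union:
  assumes "preserved_under_finite_closed_sums P" "finite \<F>" "\<F> \<noteq> {}"
    and closed: "\<And>S. S \<in> \<F> \<Longrightarrow> closedin X S"
    and P: "\<And>S. S \<in> \<F> \<Longrightarrow> P (subtopology X S)"
  shows "P (subtopology X (\<Union>\<F>))"
proof -
  have "topspace (subtopology X (\<Union>\<F>)) = \<Union>\<F>"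
    using closed closedin_subset by fastforce
  moreover have "closedin (subtopology X (\<Union>\<F>)) S" if "S \<in> \<F>" for S
    using that closed by (simp add: closedin_subset_topspace Union_upper)
  moreover have "P (subtopology (subtopology X (\<Union>\<F>)) S)" if "S \<in> \<F>" for S
    using that P by (simp add: subtopology_subtopology Int_absorb1 Union_upper)
  ultimately show ?thesis
    using assms(1)[unfolded preserved_under_finite_closed_sums_def, rule_format,
        of \<F> "subtopology X (\<Union>\<F>)"] assms(2,3) by simp
qed

lemma Coz_subset: "C \<in> Coz X \<Longrightarrow> C \<subseteq> topspace X"
  by (auto simp: Coz_def)

text \<open>The function defining \<open>C\<close> is restricted to \<open>Y\<close>.\<close>

lemma Coz_subtopology:
  assumes "C \<in> Coz X"
  shows "Y \<inter> C \<in> Coz (subtopology X Y)"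
proof -
  obtain f where f: "continuous_map X (top_of_set {0..1::real}) f"
    and C: "C = topspace X - {x \<in> topspace X. f x = 0}"
    using assms unfolding Coz_def zero_set_def by blast
  have "zero_set (subtopology X Y) {x \<in> topspace (subtopology X Y). f x = 0}"
    unfolding zero_set_def using f continuous_map_from_subtopology by blast
  moreover have "Y \<inter> C = topspace (subtopology X Y) - {x \<in> topspace (subtopology X Y). f x = 0}"
    using C by auto
  ultimately show ?thesis
    unfolding Coz_def by blast
qed

text \<open>A closed \<open>Y\<close> contains the closure in \<open>X\<close> of each of its
  subsets, so intersecting that closure with \<open>Y\<close> changes nothing.\<close>

lemma closure_of_closed_subtopology:
  assumes "closedin X Y"
  shows "subtopology X Y closure_of (Y \<inter> S) = X closure_of (Y \<inter> S)"
  using closure_of_minimal[of "Y \<inter> S" Y X] assms by (auto simp: closure_of_subtopology)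

lemma P_separation_commute: "P_separation P X C D \<longleftrightarrow> P_separation P X D C"
  unfolding P_separation_def by (auto simp: Un_commute Int_commute)

text \<open>If both alternatives failed, the traces of \<open>C\<close> and \<open>D\<close> on
  \<open>Y\<close> would separate \<open>Y\<close>, with the trace of \<open>E\<close> covering the
  remainder.\<close>

lemma P_connected_closure_of_Int:
  assumes her: "closed_hereditary P"
    and Y: "closedin X Y" "P_connected P (subtopology X Y)"
    and sep: "P_separation P X C D"
  shows "P (subtopology X (X closure_of (Y \<inter> C))) \<or> P (subtopology X (X closure_of (Y \<inter> D)))"
proof (rule ccontr)
  assume neg: "\<not> ?thesis"
  obtain E where E: "E \<in> Coz X" "topspace X - (C \<union> D) \<subseteq> E" "P (subtopology X (X closure_of E))"
    using sep unfolding P_separation_def by blast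
  \<comment> \<open>This turns each condition of a separation of \<open>Y\<close> into one about
    closures in \<open>X\<close>.\<close>
  have cl: "subtopology (subtopology X Y) (subtopology X Y closure_of (Y \<inter> S)) =
      subtopology X (X closure_of (Y \<inter> S))" for S
    using closure_of_minimal[of "Y \<inter> S" Y X] Y(1)
    by (simp add: closure_of_closed_subtopology subtopology_subtopology Int_absorb1)
  have "P (subtopology X (X closure_of (Y \<inter> E)))"
    using closed_hereditary_mono[OF her E(3)] by (simp add: closure_of_mono)
  moreover have "topspace (subtopology X Y) - (Y \<inter> C \<union> Y \<inter> D) \<subseteq> Y \<inter> E"
    using E(2) by auto
  moreover have "Y \<inter> C \<inter> (Y \<inter> D) = {}" "C \<in> Coz X" "D \<in> Coz X"
    using sep unfolding P_separation_def by auto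
  ultimately have "P_separation P (subtopology X Y) (Y \<inter> C) (Y \<inter> D)"
    unfolding P_separation_def cl using neg Coz_subtopology[of _ X Y] E(1)
    by (intro conjI bexI[of _ "Y \<inter> E"]) (simp_all add: cl)
  then show False
    using Y(2) unfolding P_connected_def P_disconnected_def by blast
qed

text \<open>Points of \<open>A\<close> outside \<open>C\<close> and \<open>D\<close> lie in
  \<open>E\<close>. Were both closures to have \<open>P\<close>, so would their union with the
  closure of \<open>E\<close>, and hence its closed subset \<open>A\<close>.\<close>

lemma P_separation_closure_of_Int:
  assumes her: "closed_hereditary P" and sums: "preserved_under_finite_closed_sums P"
    and sep: "P_separation P X C D"
    and A: "closedin X A" "\<not> P (subtopology X A)"
    and PC: "P (subtopology X (X closure_of (A \<inter> C)))"
  shows "\<not> P (subtopology X (X closure_of (A \<inter> D)))"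
proof
  assume PD: "P (subtopology X (X closure_of (A \<inter> D)))"
  obtain E where E: "E \<in> Coz X" "topspace X - (C \<union> D) \<subseteq> E" "P (subtopology X (X closure_of E))"
    using sep unfolding P_separation_def by blast
  let ?\<F> = "{X closure_of (A \<inter> C), X closure_of (A \<inter> D), X closure_of E}"
  have "P (subtopology X (\<Union>?\<F>))"
    using PC PD E(3) by (intro preserved_under_finite_closed_sums_Union[OF sums]) auto
  moreover have "A \<subseteq> \<Union>?\<F>"
  proof
    fix x assume x: "x \<in> A"
    then have "x \<in> topspace X"
      using closedin_subset[OF A(1)] by blast
    with x E(2) consider "x \<in> A \<inter> C" | "x \<in> A \<inter> D" | "x \<in> E"
      by blast
    then have "x \<in> X closure_of (A \<inter> C) \<or> x \<in> X closure_of (A \<inter> D) \<or> x \<in> X closure_of E"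
      using \<open>x \<in> topspace X\<close> by cases (auto simp: in_closure_of)
    then show "x \<in> \<Union>?\<F>"
      by simp
  qed
  ultimately show False
    using closed_hereditary_mono[OF her _ A(1), of "\<Union>?\<F>"] A(2) by simp
qed

lemma closure_of_finite_cover_Int:
  assumes "finite I" "topspace X = (\<Union>i\<in>I. F i)" "C \<subseteq> topspace X"
  shows "X closure_of C = (\<Union>i\<in>I. X closure_of (F i \<inter> C))"
proof -
  have "C = \<Union> ((\<lambda>i. F i \<inter> C) ` I)"
    using assms(2,3) by auto
  then show ?thesis
    using closure_of_Union[of "(\<lambda>i. F i \<inter> C) ` I" X] assms(1) by simp
qed

text \<open>The assumption on \<open>A \<inter> C\<close> fixes which side of the separation is
  small on \<open>A\<close>; the opposite case follows by exchanging \<open>C\<close> and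
  \<open>D\<close>.\<close>

lemma P_connected_cover_no_separation:
  assumes her: "closed_hereditary P" and sums: "preserved_under_finite_closed_sums P"
    and I: "finite I" "I \<noteq> {}" and cover: "topspace X = (\<Union>i\<in>I. F i)"
    and F: "\<And>i. i \<in> I \<Longrightarrow> closedin X (F i)"
      "\<And>i. i \<in> I \<Longrightarrow> P_connected P (subtopology X (F i))"
    and A: "closedin X A" "\<not> P (subtopology X A)" "A \<subseteq> (\<Inter>i\<in>I. F i)"
    and PC: "P (subtopology X (X closure_of (A \<inter> C)))"
  shows "\<not> P_separation P X C D"
proof
  assume sep: "P_separation P X C D"
  have "P (subtopology X (X closure_of (F i \<inter> C)))" if i: "i \<in> I" for i
  proof -
    \<comment> \<open>Failure of \<open>P\<close> passes from a closed set to any larger one, here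
      from \<open>A\<close> to \<open>F i\<close>.\<close>
    have "X closure_of (A \<inter> D) \<subseteq> X closure_of (F i \<inter> D)"
      using A(3) i by (intro closure_of_mono) auto
    then have "\<not> P (subtopology X (X closure_of (F i \<inter> D)))"
      using closed_hereditary_mono[OF her] closedin_closure_of
        P_separation_closure_of_Int[OF her sums sep A(1,2) PC] by metis
    then show ?thesis
      using P_connected_closure_of_Int[OF her F(1)[OF i] F(2)[OF i] sep] by blast
  qed
  then have "P (subtopology X (\<Union>i\<in>I. X closure_of (F i \<inter> C)))"
    using I by (intro preserved_under_finite_closed_sums_Union[OF sums]) auto
  \<comment> \<open>The union just shown to have \<open>P\<close> is the closure of
    \<open>C\<close>, because the \<open>F i\<close> cover \<open>X\<close> and closure commutes
    with finite unions.\<close>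
  moreover have "C \<subseteq> topspace X" "\<not> P (subtopology X (X closure_of C))"
    using sep Coz_subset unfolding P_separation_def by auto
  ultimately show False
    using closure_of_finite_cover_Int[OF I(1) cover] by simp
qed

theorem theorem4p2:
  fixes X :: "'a topology"
    and P :: "'a topology \<Rightarrow> bool"
    and Xs :: "nat \<Rightarrow> 'a set"
    and n :: nat
  assumes "topological_property P"
    and "closed_hereditary P"
    and "preserved_under_finite_closed_sums P"
    and "n \<ge> 1"
    and "topspace X = (\<Union>i\<in>{1..n}. Xs i)"
    and "\<And>i. i \<in> {1..n} \<Longrightarrow> closedin X (Xs i)"
    and "\<And>i. i \<in> {1..n} \<Longrightarrow> P_connected P (subtopology X (Xs i))"
    and "\<exists>A. closedin X A \<and> P_connected P (subtopology X A) \<and> \<not> P (subtopology X A) \<and>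
             A \<subseteq> (\<Inter>i\<in>{1..n}. Xs i)"
  shows "P_connected P X"
proof -
  obtain A where A: "closedin X A" "P_connected P (subtopology X A)" "\<not> P (subtopology X A)"
    "A \<subseteq> (\<Inter>i\<in>{1..n}. Xs i)"
    using assms(8) by blast
  have "{1..n} \<noteq> {}"
    using assms(4) by simp
  note no_sep = P_connected_cover_no_separation[OF assms(2,3) finite_atLeastAtMost this
      assms(5-7) A(1,3,4)]
  have "\<not> P_separation P X C D" for C D
  proof
    assume sep: "P_separation P X C D"
    \<comment> \<open>If the closure of \<open>A \<inter> D\<close> is the one with
      \<open>P\<close>, \<open>no_sep\<close> is applied to the swapped pair.\<close>
    from P_connected_closure_of_Int[OF assms(2) A(1,2) sep] show False
      using no_sep sep P_separation_commute by blast
  qed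
  then show ?thesis
    unfolding P_connected_def P_disconnected_def by blast
qed

end
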